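(* Let $G$ be a graph without isolated vertices. Then (i) $\gamma(G)\le \gamma_{Zg}(G)\le 2\gamma(G)-1$; (ii) $\gamma_t(G)\le \gamma_{Lg}(G)\le 2\gamma_t(G)-1$; and (iii) $\gamma_t(G)+1\le \gamma_{LLg}(G)\le 2\gamma_t(G)-1$.
   Context: All graphs are finite, simple and have at least one vertex. For a vertex $v$ of a graph $G$, $N(v)$ is its open neighborhood and $N[v]=N(v)\cup\{v\}$ its closed neighborhood. The domination number $\gamma(G)$ is the minimum size of a set $S\subseteq V(G)$ with $\bigcup_{s\in S}N[s]=V(G)$; the total domination number $\gamma_t(G)$ is the minimum size of a set $S\subseteq V(G)$ with $\bigcup_{s\in S}N(s)=V(G)$. Two players, Dominator and Staller, alternately select a vertex of $G$, with Dominator moving first (D-game). In the $i$-th move, after the moves $v_1,\dots,v_{i-1}$, the choice of a vertex $v_i$ is legal if - in the Z-domination game: $N(v_i)\setminus\bigcup_{j=1}^{i-1}N[v_j]\neq\emptyset$; - in the L-domination game: $N[v_i]\setminus\bigcup_{j=1}^{i-1}N(v_j)\neq\emptyset$ and $v_i\neq v_j$ for all $j<i$; - in the LL-domination game: $N[v_i]\setminus\bigcup_{j=1}^{i-1}N(v_j)\neq\emptyset$. Each game ends when no legal move is available; its length is the total number of moves played (an unending play, possible in the LL-game since vertices may be repeated there, has infinite length). Dominator wants to minimize the length, Staller wants to maximize it. The lengths of the D-games on $G$ under optimal play by both players are denoted $\gamma_{Zg}(G)$, $\gamma_{Lg}(G)$, and $\gamma_{LLg}(G)$, respectively. *)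

theory Defs
  imports "Graph_Theory.Digraph" "HOL-Library.Extended_Nat"
begin

text \<open>
  Finite simple graphs are the library's \<^locale>\<open>graph\<close>: finite digraphs with a symmetric
  arc relation and neither loops nor parallel arcs.
\<close>

definition open_nbh :: "('a, 'b) pre_digraph \<Rightarrow> 'a \<Rightarrow> 'a set" where
  "open_nbh G v = {u \<in> verts G. v \<rightarrow>\<^bsub>G\<^esub> u}"

definition closed_nbh :: "('a, 'b) pre_digraph \<Rightarrow> 'a \<Rightarrow> 'a set" where
  "closed_nbh G v = open_nbh G v \<union> {v}"

definition no_isolated_vertices :: "('a, 'b) pre_digraph \<Rightarrow> bool" where
  "no_isolated_vertices G \<longleftrightarrow> (\<forall>v \<in> verts G. open_nbh G v \<noteq> {})"

definition domination_number :: "('a, 'b) pre_digraph \<Rightarrow> nat" where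
  "domination_number G =
     (LEAST k. \<exists>S \<subseteq> verts G. (\<Union>s\<in>S. closed_nbh G s) = verts G \<and> card S = k)"

text \<open>A total dominating set exists only if there are no isolated vertices.\<close>

definition total_domination_number :: "('a, 'b) pre_digraph \<Rightarrow> nat" where
  "total_domination_number G =
     (LEAST k. \<exists>S \<subseteq> verts G. (\<Union>s\<in>S. open_nbh G s) = verts G \<and> card S = k)"

text \<open>
  A game is given by its legality predicate: \<open>legal h v\<close> says that \<open>v\<close> may be selected after
  the moves \<open>h\<close>, listed in the order in which they were made. A strategy is a function of the
  whole history that has to select a legal vertex whenever there is one.
\<close>

definition strategies :: "('a list \<Rightarrow> 'a \<Rightarrow> bool) \<Rightarrow> ('a list \<Rightarrow> 'a) set" where
  "strategies legal = {\<sigma>. \<forall>h. (\<exists>v. legal h v) \<longrightarrow> legal h (\<sigma> h)}"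

text \<open>
  The moves made in the first \<open>n\<close> rounds when Dominator follows \<open>\<sigma>\<close> and Staller follows \<open>\<tau>\<close>.
  Dominator moves first, hence at histories of even length. Once no legal move is available
  the history stays constant.
\<close>

primrec play :: "('a list \<Rightarrow> 'a \<Rightarrow> bool) \<Rightarrow> ('a list \<Rightarrow> 'a) \<Rightarrow> ('a list \<Rightarrow> 'a) \<Rightarrow> nat \<Rightarrow> 'a list" where
  "play legal \<sigma> \<tau> 0 = []"
| "play legal \<sigma> \<tau> (Suc n) =
     (let h = play legal \<sigma> \<tau> n in
      if \<exists>v. legal h v then h @ [if even (length h) then \<sigma> h else \<tau> h] else h)"

definition play_length ::
    "('a list \<Rightarrow> 'a \<Rightarrow> bool) \<Rightarrow> ('a list \<Rightarrow> 'a) \<Rightarrow> ('a list \<Rightarrow> 'a) \<Rightarrow> enat" where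
  "play_length legal \<sigma> \<tau> = (SUP n. enat (length (play legal \<sigma> \<tau> n)))"

text \<open>
  The length under optimal play, as a minimax value over strategies; an unending play has
  length \<open>\<infinity>\<close>. For each finite \<open>k\<close>, whether a play has length at most \<open>k\<close> is decided after
  finitely many moves, so these games are determined and exchanging infimum and supremum
  gives the same value.
\<close>

definition D_game_length :: "('a list \<Rightarrow> 'a \<Rightarrow> bool) \<Rightarrow> enat" where
  "D_game_length legal =
     (INF \<sigma>\<in>strategies legal. SUP \<tau>\<in>strategies legal. play_length legal \<sigma> \<tau>)"

definition Z_legal :: "('a, 'b) pre_digraph \<Rightarrow> 'a list \<Rightarrow> 'a \<Rightarrow> bool" where
  "Z_legal G h v \<longleftrightarrow> v \<in> verts G \<and> open_nbh G v - (\<Union>u\<in>set h. closed_nbh G u) \<noteq> {}"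

definition L_legal :: "('a, 'b) pre_digraph \<Rightarrow> 'a list \<Rightarrow> 'a \<Rightarrow> bool" where
  "L_legal G h v \<longleftrightarrow>
     v \<in> verts G \<and> closed_nbh G v - (\<Union>u\<in>set h. open_nbh G u) \<noteq> {} \<and> v \<notin> set h"

definition LL_legal :: "('a, 'b) pre_digraph \<Rightarrow> 'a list \<Rightarrow> 'a \<Rightarrow> bool" where
  "LL_legal G h v \<longleftrightarrow> v \<in> verts G \<and> closed_nbh G v - (\<Union>u\<in>set h. open_nbh G u) \<noteq> {}"

definition Z_game_number :: "('a, 'b) pre_digraph \<Rightarrow> enat" where
  "Z_game_number G = D_game_length (Z_legal G)"

definition L_game_number :: "('a, 'b) pre_digraph \<Rightarrow> enat" where
  "L_game_number G = D_game_length (L_legal G)"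

definition LL_game_number :: "('a, 'b) pre_digraph \<Rightarrow> enat" where
  "LL_game_number G = D_game_length (LL_legal G)"

end

(*
  Upper bounds: fix a minimum (total) dominating set S. Whenever a move is legal, some s in S
  has a neighborhood that is not yet dominated, and Dominator can complete the domination of
  this neighborhood with one legal move, so he moves at most card S times. Lower bounds: as
  there are no isolated vertices, the moves of a finished game form a (total) dominating set. In
  the LL-game Staller answers the first move by repeating it, which wastes one move.
*)

theory Submission
  imports Defs
begin

section \<open>Plays and their lengths\<close>

lemma strategies_legal:
  assumes "\<sigma> \<in> strategies legal" and "legal h v"
  shows "legal h (\<sigma> h)"
  using assms by (auto simp: strategies_def)

text \<open>A strategy sees the whole history, so its moves can be chosen independently at each
  history. Where no move is legal its value is unconstrained.\<close>

lemma some_strategy: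
  assumes "\<And>h v. legal h v \<Longrightarrow> \<exists>w. legal h w \<and> Q h w"
  obtains \<sigma> where "\<sigma> \<in> strategies legal" and "\<And>h v. legal h v \<Longrightarrow> Q h (\<sigma> h)"
proof -
  obtain \<sigma> where "\<And>h v. legal h v \<Longrightarrow> legal h (\<sigma> h) \<and> Q h (\<sigma> h)"
    using assms by metis
  then show thesis
    by (intro that[of \<sigma>]) (auto simp: strategies_def)
qed

lemma length_play_le_play_length:
  "enat (length (play legal \<sigma> \<tau> n)) \<le> play_length legal \<sigma> \<tau>"
  unfolding play_length_def by (rule SUP_upper) simp

text \<open>An unending play gains a move in every round and so exceeds any finite bound. Hence only
  finished positions need to be examined.\<close>

lemma enat_le_play_length:
  assumes "\<And>n. \<not> (\<exists>v. legal (play legal \<sigma> \<tau> n) v) \<Longrightarrow> k \<le> length (play legal \<sigma> \<tau> n)"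
  shows "enat k \<le> play_length legal \<sigma> \<tau>"
proof (cases "\<exists>n. \<not> (\<exists>v. legal (play legal \<sigma> \<tau> n) v)")
  case True
  then obtain n where "k \<le> length (play legal \<sigma> \<tau> n)"
    using assms by blast
  then show ?thesis
    using length_play_le_play_length[of legal \<sigma> \<tau> n] by (meson enat_ord_simps(1) order_trans)
next
  case False
  have "length (play legal \<sigma> \<tau> n) = n" for n
    using False by (induction n) (auto simp: Let_def)
  then show ?thesis
    using length_play_le_play_length[of legal \<sigma> \<tau> k] by simp
qed

lemma set_play_subset:
  assumes "\<And>h v. legal h v \<Longrightarrow> v \<in> V"
    and "\<sigma> \<in> strategies legal" and "\<tau> \<in> strategies legal"
  shows "set (play legal \<sigma> \<tau> n) \<subseteq> V"
  by (induction n)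
    (auto simp: Let_def intro: assms(1) strategies_legal[OF assms(2)] strategies_legal[OF assms(3)])

lemma D_game_length_ge:
  assumes "\<tau> \<in> strategies legal"
    and "\<And>\<sigma>. \<sigma> \<in> strategies legal \<Longrightarrow> k \<le> play_length legal \<sigma> \<tau>"
  shows "k \<le> D_game_length legal"
  unfolding D_game_length_def
  using assms by (intro INF_greatest) (auto intro: SUP_upper2)

text \<open>A potential argument: no move raises \<mu>, and Dominator can lower it whenever the game
  is not over. So he moves at most \<open>\<mu> []\<close> times, and since he moves first, Staller
  has at most \<open>\<mu> [] - 1\<close> moves in between.\<close>

lemma D_game_length_le:
  fixes \<mu> :: "'a list \<Rightarrow> nat"
  assumes mono: "\<And>h v. \<mu> (h @ [v]) \<le> \<mu> h"
    and progress: "\<And>h v. legal h v \<Longrightarrow> \<exists>w. legal h w \<and> \<mu> (h @ [w]) < \<mu> h"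
  shows "D_game_length legal \<le> enat (2 * \<mu> [] - 1)"
proof -
  obtain \<sigma> where \<sigma>: "\<sigma> \<in> strategies legal"
    and decr: "\<And>h v. legal h v \<Longrightarrow> \<mu> (h @ [\<sigma> h]) < \<mu> h"
    using some_strategy[of legal "\<lambda>h w. \<mu> (h @ [w]) < \<mu> h"] progress by metis
  have "play_length legal \<sigma> \<tau> \<le> enat (2 * \<mu> [] - 1)" for \<tau>
  proof -
    let ?h = "play legal \<sigma> \<tau>"
    \<comment> \<open>\<open>length + length mod 2\<close> is twice the number of Dominator's moves
      so far, so the first conjunct says that these moves together with the remaining potential
      never exceed \<open>\<mu> []\<close>. It would still admit a play of length
      \<open>2 * \<mu> []\<close>, which the second conjunct excludes.\<close>
    have "length (?h n) + 2 * \<mu> (?h n) + length (?h n) mod 2 \<le> 2 * \<mu> []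
        \<and> length (?h n) \<le> 2 * \<mu> [] - 1" for n
    proof (induction n)
      case 0
      then show ?case by simp
    next
      case (Suc n)
      show ?case
      proof (cases "\<exists>v. legal (?h n) v")
        case True
        \<comment> \<open>This is also used when Staller is to move, where \<sigma> is not actually
          followed: it shows that the potential is still positive, so Staller never makes move
          number \<open>2 * \<mu> []\<close>.\<close>
        then have less: "\<mu> (?h n @ [\<sigma> (?h n)]) < \<mu> (?h n)"
          using decr by blast
        show ?thesis
        proof (cases "even (length (?h n))")
          case even: True
          then have "?h (Suc n) = ?h n @ [\<sigma> (?h n)]"
            using True by (simp add: Let_def)
          moreover from even have "length (?h n) mod 2 = 0" "Suc (length (?h n)) mod 2 = 1"
            by presburger+
          ultimately show ?thesis
            using Suc less by (auto simp del: play.simps)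
        next
          case odd: False
          then have "?h (Suc n) = ?h n @ [\<tau> (?h n)]"
            using True by (simp add: Let_def)
          moreover from odd have "length (?h n) mod 2 = 1" "Suc (length (?h n)) mod 2 = 0"
            by presburger+
          ultimately show ?thesis
            using Suc less mono[of "?h n" "\<tau> (?h n)"] by (auto simp del: play.simps)
        qed
      next
        case False
        then have "?h (Suc n) = ?h n"
          by (simp add: Let_def)
        with Suc show ?thesis by metis
      qed
    qed
    then show ?thesis
      unfolding play_length_def by (intro SUP_least) simp
  qed
  then show ?thesis
    unfolding D_game_length_def by (intro INF_lower2[OF \<sigma>] SUP_least)
qed

text \<open>The potential is the number of \<open>s\<close> in \<open>S\<close> whose neighborhood
  \<open>N s\<close> is not yet covered. A move \<open>v\<close> covers \<open>C v\<close>; both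
  \<open>N\<close> and \<open>C\<close> become closed neighborhoods in the Z-game and open ones in
  the other two games.\<close>

lemma D_game_length_le_card:
  assumes "finite S"
    and unfinished: "\<And>h v. legal h v \<Longrightarrow> \<exists>s\<in>S. \<not> N s \<subseteq> (\<Union>u\<in>set h. C u)"
    and move: "\<And>h s. s \<in> S \<Longrightarrow> \<not> N s \<subseteq> (\<Union>u\<in>set h. C u) \<Longrightarrow>
      \<exists>v. legal h v \<and> N s \<subseteq> (\<Union>u\<in>set h. C u) \<union> C v"
  shows "D_game_length legal \<le> enat (2 * card S - 1)"
proof -
  define T where "T h = {s \<in> S. \<not> N s \<subseteq> (\<Union>u\<in>set h. C u)}" for h
  have fin: "finite (T h)" for h
    using \<open>finite S\<close> by (simp add: T_def)
  have mono: "T (h @ [v]) \<subseteq> T h" for h v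
    by (auto simp: T_def)
  have "D_game_length legal \<le> enat (2 * card (T []) - 1)"
  proof (rule D_game_length_le)
    show "card (T (h @ [v])) \<le> card (T h)" for h v
      using mono fin by (rule card_mono[rotated])
  next
    fix h v
    assume "legal h v"
    then obtain s where s: "s \<in> T h"
      using unfinished[of h v] unfolding T_def by blast
    then obtain w where "legal h w" and w: "N s \<subseteq> (\<Union>u\<in>set h. C u) \<union> C w"
      using move[of s h] unfolding T_def by blast
    \<comment> \<open>The move \<open>w\<close> need not be \<open>s\<close>; it only has to
      complete the covering of \<open>N s\<close>.\<close>
    moreover have "s \<notin> T (h @ [w])"
      using w by (auto simp: T_def)
    with s have "T (h @ [w]) \<subset> T h"
      using mono[of h w] by blast
    then have "card (T (h @ [w])) < card (T h)"
      using fin by (rule psubset_card_mono[rotated])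
    ultimately show "\<exists>w. legal h w \<and> card (T (h @ [w])) < card (T h)"
      by blast
  qed
  also have "card (T []) \<le> card S"
    using \<open>finite S\<close> by (intro card_mono) (auto simp: T_def)
  then have "enat (2 * card (T []) - 1) \<le> enat (2 * card S - 1)"
    by simp
  finally show ?thesis .
qed

section \<open>Neighborhoods and domination numbers\<close>

lemma open_nbh_commute:
  assumes "graph G" and "u \<in> open_nbh G v"
  shows "v \<in> open_nbh G u"
proof -
  interpret graph G by fact
  show ?thesis
    using assms(2) by (auto simp: open_nbh_def intro: adj_in_verts arcs_ends_symmetric[OF sym_arcs])
qed

lemma not_in_own_open_nbh:
  assumes "graph G"
  shows "v \<notin> open_nbh G v"
proof -
  interpret graph G by fact
  show ?thesis
    by (auto simp: open_nbh_def dest: adj_not_same)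
qed

lemma open_nbh_subset_verts: "open_nbh G v \<subseteq> verts G"
  by (auto simp: open_nbh_def)

lemma domination_number_le:
  assumes "S \<subseteq> verts G" and "verts G \<subseteq> (\<Union>s\<in>S. closed_nbh G s)"
  shows "domination_number G \<le> card S"
  unfolding domination_number_def
  using assms by (intro Least_le exI[of _ S]) (auto simp: closed_nbh_def open_nbh_def)

lemma total_domination_number_le:
  assumes "S \<subseteq> verts G" and "verts G \<subseteq> (\<Union>s\<in>S. open_nbh G s)"
  shows "total_domination_number G \<le> card S"
  unfolding total_domination_number_def
  using assms by (intro Least_le exI[of _ S]) (auto simp: open_nbh_def)

lemma minimum_dominating_set:
  obtains S where "S \<subseteq> verts G" and "(\<Union>s\<in>S. closed_nbh G s) = verts G"
    and "card S = domination_number G"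
proof -
  have "\<exists>k. \<exists>S \<subseteq> verts G. (\<Union>s\<in>S. closed_nbh G s) = verts G \<and> card S = k"
    by (intro exI[of _ "card (verts G)"] exI[of _ "verts G"]) (auto simp: closed_nbh_def open_nbh_def)
  then have "\<exists>S \<subseteq> verts G. (\<Union>s\<in>S. closed_nbh G s) = verts G \<and> card S = domination_number G"
    unfolding domination_number_def by (rule LeastI_ex)
  then show thesis
    by (elim exE conjE) (rule that)
qed

text \<open>Without isolated vertices the whole vertex set is totally dominating, so the
  \<open>LEAST\<close> in the definition is attained.\<close>

lemma minimum_total_dominating_set:
  assumes "graph G" and "no_isolated_vertices G"
  obtains S where "S \<subseteq> verts G" and "(\<Union>s\<in>S. open_nbh G s) = verts G"
    and "card S = total_domination_number G"
proof -
  have "verts G \<subseteq> (\<Union>s\<in>verts G. open_nbh G s)"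
  proof
    fix v
    assume "v \<in> verts G"
    then obtain u where u: "u \<in> open_nbh G v"
      using assms(2) unfolding no_isolated_vertices_def by blast
    then have "v \<in> open_nbh G u" "u \<in> verts G"
      using open_nbh_commute[OF assms(1)] open_nbh_subset_verts[of G] by blast+
    then show "v \<in> (\<Union>s\<in>verts G. open_nbh G s)"
      by blast
  qed
  then have "\<exists>k. \<exists>S \<subseteq> verts G. (\<Union>s\<in>S. open_nbh G s) = verts G \<and> card S = k"
    by (intro exI[of _ "card (verts G)"] exI[of _ "verts G"]) (auto simp: open_nbh_def)
  then have "\<exists>S \<subseteq> verts G. (\<Union>s\<in>S. open_nbh G s) = verts G \<and> card S = total_domination_number G"
    unfolding total_domination_number_def by (rule LeastI_ex)
  then show thesis
    by (elim exE conjE) (rule that)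
qed

section \<open>Bounds for the three games\<close>

text \<open>Any neighbor of an undominated vertex would still be a legal move.\<close>

lemma Z_finished_dominating:
  assumes "graph G" and "no_isolated_vertices G" and "\<not> (\<exists>v. Z_legal G h v)"
  shows "verts G \<subseteq> (\<Union>u\<in>set h. closed_nbh G u)"
proof
  fix u
  assume "u \<in> verts G"
  then obtain w where "w \<in> open_nbh G u"
    using assms(2) unfolding no_isolated_vertices_def by blast
  then have "w \<in> verts G" "u \<in> open_nbh G w"
    using open_nbh_commute[OF assms(1)] open_nbh_subset_verts[of G] by blast+
  then show "u \<in> (\<Union>u\<in>set h. closed_nbh G u)"
    using assms(3) unfolding Z_legal_def by blast
qed

text \<open>An undominated \<open>u\<close> may itself have been played already, so it need not be a
  legal move. A neighbor of \<open>u\<close> cannot have been played, since that would have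
  dominated \<open>u\<close>; hence it is legal.\<close>

lemma L_finished_total_dominating:
  assumes "graph G" and "no_isolated_vertices G" and "\<not> (\<exists>v. L_legal G h v)"
  shows "verts G \<subseteq> (\<Union>u\<in>set h. open_nbh G u)"
proof
  fix u
  assume "u \<in> verts G"
  then obtain w where "w \<in> open_nbh G u"
    using assms(2) unfolding no_isolated_vertices_def by blast
  then have "w \<in> verts G" "u \<in> open_nbh G w"
    using open_nbh_commute[OF assms(1)] open_nbh_subset_verts[of G] by blast+
  then show "u \<in> (\<Union>u\<in>set h. open_nbh G u)"
    using assms(3) unfolding L_legal_def closed_nbh_def by blast
qed

lemma LL_legal_if_L_legal: "L_legal G h v \<Longrightarrow> LL_legal G h v"
  by (auto simp: L_legal_def LL_legal_def)

text \<open>Every finished play yields a dominating set, so an arbitrary strategy of Staller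
  suffices.\<close>

lemma Z_game_number_ge:
  assumes "graph G" and "no_isolated_vertices G"
  shows "enat (domination_number G) \<le> Z_game_number G"
proof -
  obtain \<tau> where \<tau>: "\<tau> \<in> strategies (Z_legal G)"
    using some_strategy[of "Z_legal G" "\<lambda>_ _. True"] by blast
  show ?thesis
    unfolding Z_game_number_def
  proof (rule D_game_length_ge[OF \<tau>], rule enat_le_play_length)
    fix \<sigma> n
    assume \<sigma>: "\<sigma> \<in> strategies (Z_legal G)"
    let ?h = "play (Z_legal G) \<sigma> \<tau> n"
    assume "\<not> (\<exists>v. Z_legal G ?h v)"
    then have "verts G \<subseteq> (\<Union>u\<in>set ?h. closed_nbh G u)"
      by (rule Z_finished_dominating[OF assms])
    moreover have "set ?h \<subseteq> verts G"
      by (rule set_play_subset[OF _ \<sigma> \<tau>]) (simp add: Z_legal_def)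
    ultimately have "domination_number G \<le> card (set ?h)"
      by (rule domination_number_le[rotated])
    also have "\<dots> \<le> length ?h"
      by (rule card_length)
    finally show "domination_number G \<le> length ?h" .
  qed
qed

lemma Z_game_number_le:
  assumes "graph G" and "no_isolated_vertices G"
  shows "Z_game_number G \<le> enat (2 * domination_number G - 1)"
proof -
  interpret graph G by fact
  obtain S where S: "S \<subseteq> verts G" "(\<Union>s\<in>S. closed_nbh G s) = verts G"
    and card: "card S = domination_number G"
    by (rule minimum_dominating_set)
  have "D_game_length (Z_legal G) \<le> enat (2 * card S - 1)"
  proof (rule D_game_length_le_card)
    show "finite S"
      using S(1) by (rule finite_subset) simp
  next
    fix h v
    assume "Z_legal G h v"
    then obtain u where "u \<in> verts G" "u \<notin> (\<Union>u\<in>set h. closed_nbh G u)"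
      using open_nbh_subset_verts[of G v] unfolding Z_legal_def by blast
    then show "\<exists>s\<in>S. \<not> closed_nbh G s \<subseteq> (\<Union>u\<in>set h. closed_nbh G u)"
      using S(2) by blast
  next
    fix h s
    let ?C = "\<Union>u\<in>set h. closed_nbh G u"
    assume s: "s \<in> S" and "\<not> closed_nbh G s \<subseteq> ?C"
    \<comment> \<open>If only \<open>s\<close> itself is undominated, then \<open>s\<close> is not a legal move, but every neighbor is.\<close>
    show "\<exists>v. Z_legal G h v \<and> closed_nbh G s \<subseteq> ?C \<union> closed_nbh G v"
    proof (cases "open_nbh G s \<subseteq> ?C")
      case False
      with s S(1) have "Z_legal G h s"
        unfolding Z_legal_def by blast
      then show ?thesis by blast
    next
      case True
      then have "s \<notin> ?C"
        using \<open>\<not> closed_nbh G s \<subseteq> ?C\<close> unfolding closed_nbh_def by blast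
      obtain w where w: "w \<in> open_nbh G s"
        using assms(2) s S(1) unfolding no_isolated_vertices_def by blast
      then have "s \<in> open_nbh G w" "w \<in> verts G"
        using open_nbh_commute[OF assms(1)] open_nbh_subset_verts[of G] by blast+
      then have "Z_legal G h w" "closed_nbh G s \<subseteq> ?C \<union> closed_nbh G w"
        using True \<open>s \<notin> ?C\<close> unfolding Z_legal_def closed_nbh_def by blast+
      then show ?thesis by blast
    qed
  qed
  then show ?thesis
    by (simp add: Z_game_number_def card)
qed

lemma L_game_number_ge:
  assumes "graph G" and "no_isolated_vertices G"
  shows "enat (total_domination_number G) \<le> L_game_number G"
proof -
  obtain \<tau> where \<tau>: "\<tau> \<in> strategies (L_legal G)"
    using some_strategy[of "L_legal G" "\<lambda>_ _. True"] by blast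
  show ?thesis
    unfolding L_game_number_def
  proof (rule D_game_length_ge[OF \<tau>], rule enat_le_play_length)
    fix \<sigma> n
    assume \<sigma>: "\<sigma> \<in> strategies (L_legal G)"
    let ?h = "play (L_legal G) \<sigma> \<tau> n"
    assume "\<not> (\<exists>v. L_legal G ?h v)"
    then have "verts G \<subseteq> (\<Union>u\<in>set ?h. open_nbh G u)"
      by (rule L_finished_total_dominating[OF assms])
    moreover have "set ?h \<subseteq> verts G"
      by (rule set_play_subset[OF _ \<sigma> \<tau>]) (simp add: L_legal_def)
    ultimately have "total_domination_number G \<le> card (set ?h)"
      by (rule total_domination_number_le[rotated])
    also have "\<dots> \<le> length ?h"
      by (rule card_length)
    finally show "total_domination_number G \<le> length ?h" .
  qed
qed

text \<open>The rules may lie anywhere between those of the L-game and those of the LL-game, so one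
  argument serves both: Dominator's moves are legal even in the L-game, and a move legal in the
  LL-game already shows that some vertex is undominated.\<close>

lemma D_game_length_le_total_domination_number:
  assumes "graph G" and "no_isolated_vertices G"
    and L_legal: "\<And>h v. L_legal G h v \<Longrightarrow> legal h v"
    and LL_legal: "\<And>h v. legal h v \<Longrightarrow> LL_legal G h v"
  shows "D_game_length legal \<le> enat (2 * total_domination_number G - 1)"
proof -
  interpret graph G by fact
  obtain S where S: "S \<subseteq> verts G" "(\<Union>s\<in>S. open_nbh G s) = verts G"
    and card: "card S = total_domination_number G"
    by (rule minimum_total_dominating_set[OF assms(1,2)])
  have "D_game_length legal \<le> enat (2 * card S - 1)"
  proof (rule D_game_length_le_card)
    show "finite S"
      using S(1) by (rule finite_subset) simp
  next
    fix h v
    assume "legal h v"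
    then have "LL_legal G h v"
      by (rule LL_legal)
    then obtain u where "u \<in> verts G" "u \<notin> (\<Union>u\<in>set h. open_nbh G u)"
      using open_nbh_subset_verts[of G v] unfolding LL_legal_def closed_nbh_def by blast
    then show "\<exists>s\<in>S. \<not> open_nbh G s \<subseteq> (\<Union>u\<in>set h. open_nbh G u)"
      using S(2) by blast
  next
    fix h s
    assume "s \<in> S" and "\<not> open_nbh G s \<subseteq> (\<Union>u\<in>set h. open_nbh G u)"
    \<comment> \<open>Had \<open>s\<close> been played, its open neighborhood would be covered; so
      the ban on repetition does not affect \<open>s\<close>.\<close>
    then have "L_legal G h s"
      using S(1) unfolding L_legal_def closed_nbh_def by blast
    then show "\<exists>v. legal h v \<and> open_nbh G s \<subseteq> (\<Union>u\<in>set h. open_nbh G u) \<union> open_nbh G v"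
      using L_legal by blast
  qed
  then show ?thesis
    by (simp add: card)
qed

text \<open>Histories only grow, so an early repetition is still present in the finished
  play.\<close>

lemma not_distinct_play:
  assumes "\<not> distinct (play legal \<sigma> \<tau> m)" and "m \<le> n"
  shows "\<not> distinct (play legal \<sigma> \<tau> n)"
  using assms(2,1) by (induction n rule: dec_induct) (auto simp: Let_def)

lemma LL_game_number_ge:
  assumes "graph G" and "verts G \<noteq> {}" and "no_isolated_vertices G"
  shows "enat (total_domination_number G + 1) \<le> LL_game_number G"
proof -
  \<comment> \<open>After the single move \<open>v\<close>, the vertex \<open>v\<close> itself is
    not totally dominated, and it lies in its own closed neighborhood.\<close>
  have again: "LL_legal G [v] v" if "v \<in> verts G" for v
    using that not_in_own_open_nbh[OF assms(1)] by (auto simp: LL_legal_def closed_nbh_def)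
  \<comment> \<open>Staller repeats the last move whenever this is legal and plays any legal move
    otherwise. For the empty history \<open>last h\<close> is unspecified, which is harmless since
    only the reply to \<open>[v]\<close> matters.\<close>
  have "\<exists>w. LL_legal G h w \<and> (LL_legal G h (last h) \<longrightarrow> w = last h)" if "LL_legal G h v" for h v
    using that by blast
  then obtain \<tau> where \<tau>: "\<tau> \<in> strategies (LL_legal G)"
    and repeat: "\<And>h v. LL_legal G h v \<Longrightarrow> LL_legal G h (last h) \<longrightarrow> \<tau> h = last h"
    using some_strategy[of "LL_legal G" "\<lambda>h w. LL_legal G h (last h) \<longrightarrow> w = last h"] by blast
  show ?thesis
    unfolding LL_game_number_def
  proof (rule D_game_length_ge[OF \<tau>], rule enat_le_play_length)
    fix \<sigma> n
    assume \<sigma>: "\<sigma> \<in> strategies (LL_legal G)"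
    let ?play = "play (LL_legal G) \<sigma> \<tau>"
    assume finished: "\<not> (\<exists>v. LL_legal G (?play n) v)"
    have start: "\<exists>v. LL_legal G [] v"
      using assms(2) by (auto simp: LL_legal_def closed_nbh_def)
    define v where "v = \<sigma> []"
    have v: "LL_legal G [] v"
      using start strategies_legal[OF \<sigma>] unfolding v_def by blast
    then have v': "LL_legal G [v] v"
      using again by (simp add: LL_legal_def)
    have play1: "?play 1 = [v]"
      using start by (simp add: v_def)
    have play2: "?play 2 = [v, v]"
      using play1 v' repeat[OF v'] by (auto simp: numeral_2_eq_2 Let_def)
    \<comment> \<open>The game cannot be over before Staller's repetition, so the finished play
      contains it.\<close>
    have "n \<noteq> 0" "n \<noteq> 1"
      using finished start v' play1 by (metis play.simps(1)) (metis finished play1 v')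
    then have "2 \<le> n"
      by simp
    then have "\<not> distinct (?play n)"
      using not_distinct_play[of "LL_legal G" \<sigma> \<tau> 2] play2 by simp
    \<comment> \<open>The repeated vertex counts twice in the length but once in the total
      dominating set; this is the extra 1 in the bound.\<close>
    then have less: "card (set (?play n)) < length (?play n)"
      using card_distinct card_length le_neq_implies_less by blast
    \<comment> \<open>The LL-game allows every move that the L-game allows, so a position finished
      in the former is finished in the latter.\<close>
    have "\<not> (\<exists>v. L_legal G (?play n) v)"
      using finished by (auto dest: LL_legal_if_L_legal)
    then have "verts G \<subseteq> (\<Union>u\<in>set (?play n). open_nbh G u)"
      by (rule L_finished_total_dominating[OF assms(1,3)])
    moreover have "set (?play n) \<subseteq> verts G"
      by (rule set_play_subset[OF _ \<sigma> \<tau>]) (simp add: LL_legal_def)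
    ultimately have "total_domination_number G \<le> card (set (?play n))"
      by (rule total_domination_number_le[rotated])
    with less show "total_domination_number G + 1 \<le> length (?play n)"
      by simp
  qed
qed

theorem proposition4p1:
  fixes G :: "('a, 'b) pre_digraph"
  assumes "graph G"
    and "verts G \<noteq> {}"
    and "no_isolated_vertices G"
  shows "(enat (domination_number G) \<le> Z_game_number G \<and>
          Z_game_number G \<le> enat (2 * domination_number G - 1)) \<and>
         (enat (total_domination_number G) \<le> L_game_number G \<and>
          L_game_number G \<le> enat (2 * total_domination_number G - 1)) \<and>
         (enat (total_domination_number G + 1) \<le> LL_game_number G \<and>
          LL_game_number G \<le> enat (2 * total_domination_number G - 1))"
proof -
  have "L_game_number G \<le> enat (2 * total_domination_number G - 1)"
    unfolding L_game_number_def
    using assms(1,3) by (rule D_game_length_le_total_domination_number) (auto intro: LL_legal_if_L_legal)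
  moreover have "LL_game_number G \<le> enat (2 * total_domination_number G - 1)"
    unfolding LL_game_number_def
    using assms(1,3) by (rule D_game_length_le_total_domination_number) (auto intro: LL_legal_if_L_legal)
  ultimately show ?thesis
    using assms Z_game_number_ge Z_game_number_le L_game_number_ge LL_game_number_ge by blast
qed

end
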